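(* For any permutation $\sigma\in\mathfrak S_n$, with $\tau=\Phi(\sigma)$, $$\sum_{i=1}^n|\sigma_i-i|=2\big([21](\tau)+[2,31](\tau)+[31,2](\tau)\big).$$
   Context: The fundamental bijection $\Phi$: write $\sigma$ in cycle notation with each cycle beginning with its largest element and cycles ordered by increasing largest element; erasing parentheses gives the one-line notation of $\Phi(\sigma)$. For $\tau\in\mathfrak S_n$: $[21](\tau)$ is the number of positions $j$ with $\tau_j>\tau_{j+1}$; $[2,31](\tau)$ is the number of pairs of positions $i<j$ with $\tau_{j+1}<\tau_i<\tau_j$; $[31,2](\tau)$ is the number of pairs of positions $i,j$ with $i+1<j$ and $\tau_{i+1}<\tau_j<\tau_i$. *)

theory Defs
  imports "HOL-Combinatorics.Combinatorics"
begin

text \<open>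
  An element of the symmetric group on \<open>{1..n}\<close> is a function \<open>\<sigma>\<close> with \<open>\<sigma> permutes {1..n}\<close>.
  For such \<open>\<sigma>\<close>, \<open>support \<sigma> m\<close> is the list \<open>[m, \<sigma> m, \<sigma> (\<sigma> m), \<dots>]\<close> going once around the cycle
  of \<open>m\<close>; for a fixed point it is \<open>[m]\<close>, so fixed points occur below as cycles of length one.
\<close>

definition cycle_maxima :: "nat \<Rightarrow> (nat \<Rightarrow> nat) \<Rightarrow> nat set" where
  "cycle_maxima n \<sigma> = {m \<in> {1..n}. \<forall>x \<in> set (support \<sigma> m). x \<le> m}"

definition canonical_cycles :: "nat \<Rightarrow> (nat \<Rightarrow> nat) \<Rightarrow> nat list list" where
  "canonical_cycles n \<sigma> = map (support \<sigma>) (sorted_list_of_set (cycle_maxima n \<sigma>))"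

text \<open>
  \<open>fundamental_bij n \<sigma>\<close> is the one-line notation of the image of \<open>\<sigma>\<close> under the fundamental
  bijection, as a list: the \<open>j\<close>-th letter (\<open>1 \<le> j \<le> n\<close>) is the list entry with index \<open>j - 1\<close>.
\<close>

definition fundamental_bij :: "nat \<Rightarrow> (nat \<Rightarrow> nat) \<Rightarrow> nat list" where
  "fundamental_bij n \<sigma> = concat (canonical_cycles n \<sigma>)"

text \<open>
  Numbers of occurrences of the vincular patterns 21 (adjacent letters), 2,31 and 31,2 in a word.
  Positions are 0-based list indices.
\<close>

definition occ_21 :: "nat list \<Rightarrow> nat" where
  "occ_21 \<tau> = card {j. j + 1 < length \<tau> \<and> \<tau> ! j > \<tau> ! (j + 1)}"

definition occ_2_31 :: "nat list \<Rightarrow> nat" where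
  "occ_2_31 \<tau> = card {(i, j). i < j \<and> j + 1 < length \<tau> \<and> \<tau> ! (j + 1) < \<tau> ! i \<and> \<tau> ! i < \<tau> ! j}"

definition occ_31_2 :: "nat list \<Rightarrow> nat" where
  "occ_31_2 \<tau> = card {(i, j). i + 1 < j \<and> j < length \<tau> \<and> \<tau> ! (i + 1) < \<tau> ! j \<and> \<tau> ! j < \<tau> ! i}"

lemma fundamental_bij_in_permutations:
  assumes \<sigma>: "\<sigma> permutes {1..n}"
  shows "fundamental_bij n \<sigma> \<in> permutations_of_set {1..n}"
proof -
  let ?S = "\<lambda>m. set (support \<sigma> m)"
  have perm: "permutation \<sigma>"
    using \<sigma> permutation_permutes by blast
  have self: "m \<in> ?S m" for m
    using least_power_of_permutation(2)[OF perm, of m] by force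
  have in_range: "?S m \<subseteq> {1..n}" if "m \<in> {1..n}" for m
    using \<sigma> that permutes_in_funpow_image[OF \<sigma> that] by auto
  have eq: "?S a = ?S b" if "?S a \<inter> ?S b \<noteq> {}" for a b
    using disjoint_support[OF perm] that unfolding disjoint_def by blast
  have fin: "finite (cycle_maxima n \<sigma>)"
    unfolding cycle_maxima_def by simp
  have max_uniq: "a = b" if "a \<in> cycle_maxima n \<sigma>" "b \<in> cycle_maxima n \<sigma>" "?S a \<inter> ?S b \<noteq> {}" for a b
  proof -
    have "b \<in> ?S a" "a \<in> ?S b" using eq[OF that(3)] self by blast+
    then have "b \<le> a" "a \<le> b" using that(1,2) unfolding cycle_maxima_def by blast+
    then show ?thesis by simp
  qed
  have "inj_on (support \<sigma>) (cycle_maxima n \<sigma>)"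
  proof (rule inj_onI)
    fix a b assume ab: "a \<in> cycle_maxima n \<sigma>" "b \<in> cycle_maxima n \<sigma>" "support \<sigma> a = support \<sigma> b"
    have "a \<in> ?S b" using self[of a] ab(3) by simp
    then show "a = b" using max_uniq[OF ab(1,2)] self[of a] by blast
  qed
  then have "distinct (canonical_cycles n \<sigma>)"
    unfolding canonical_cycles_def using fin by (simp add: distinct_map)
  moreover have "distinct ys" if "ys \<in> set (canonical_cycles n \<sigma>)" for ys
  proof -
    obtain a where "ys = support \<sigma> a"
      using \<open>ys \<in> _\<close> unfolding canonical_cycles_def by auto
    then show ?thesis using cycle_of_permutation[OF perm] by blast
  qed
  moreover have "set ys \<inter> set zs = {}"
    if yz: "ys \<in> set (canonical_cycles n \<sigma>)" "zs \<in> set (canonical_cycles n \<sigma>)" "ys \<noteq> zs" for ys zs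
  proof -
    obtain a b where "a \<in> cycle_maxima n \<sigma>" "b \<in> cycle_maxima n \<sigma>" "ys = support \<sigma> a" "zs = support \<sigma> b"
      using yz fin unfolding canonical_cycles_def by auto
    then show ?thesis using max_uniq yz(3) by blast
  qed
  ultimately have "distinct (fundamental_bij n \<sigma>)"
    unfolding fundamental_bij_def by (intro distinct_concat) auto
  moreover have "set (fundamental_bij n \<sigma>) = (\<Union>m \<in> cycle_maxima n \<sigma>. ?S m)"
    unfolding fundamental_bij_def canonical_cycles_def using fin by simp
  moreover have "(\<Union>m \<in> cycle_maxima n \<sigma>. ?S m) = {1..n}"
  proof
    show "(\<Union>m \<in> cycle_maxima n \<sigma>. ?S m) \<subseteq> {1..n}"
      using in_range unfolding cycle_maxima_def by blast
    show "{1..n} \<subseteq> (\<Union>m \<in> cycle_maxima n \<sigma>. ?S m)"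
    proof
      fix x assume x: "x \<in> {1..n}"
      define m where "m = Max (?S x)"
      have m: "m \<in> ?S x" unfolding m_def using self[of x] by (intro Max_in) auto
      then have e: "?S m = ?S x" using eq self by blast
      have "\<forall>y \<in> ?S m. y \<le> m" unfolding e unfolding m_def by (meson List.finite_set Max_ge)
      then have "m \<in> cycle_maxima n \<sigma>"
        using m in_range[OF x] unfolding cycle_maxima_def by blast
      then show "x \<in> (\<Union>m \<in> cycle_maxima n \<sigma>. ?S m)" using e self by blast
    qed
  qed
  ultimately show ?thesis by (simp add: permutations_of_set_def)
qed

end

theory Submission
  imports Defs
begin

text \<open>
  The displacements of a permutation sum to zero, so the left-hand side is twice the sum of
  \<open>x - \<sigma> x\<close> over all \<open>x\<close> with \<open>\<sigma> x < x\<close>. In \<open>\<tau>\<close>, a letter \<open>x\<close> is followed by \<open>\<sigma> x\<close> unless it ends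
  its cycle; in that case \<open>\<sigma> x\<close> is the maximum of the cycle and the next letter is a larger cycle
  maximum, so neither \<open>\<sigma> x < x\<close> nor a descent of \<open>\<tau>\<close> occurs there. Hence the sum is the total drop
  over the descents of \<open>\<tau>\<close>. A descent from \<open>a\<close> to \<open>b\<close> contributes \<open>a - b\<close>, the number of values \<open>v\<close>
  with \<open>b \<le> v < a\<close>: the value \<open>b\<close> is an occurrence of 21, and each other \<open>v\<close> lies to the left of the
  descent (an occurrence of 2,31) or to its right (an occurrence of 31,2).
\<close>

text \<open>Subtraction is truncated, so that only descents contribute.\<close>

definition total_drop :: "nat list \<Rightarrow> nat" where
  "total_drop xs = (\<Sum>j < length xs - 1. xs ! j - xs ! Suc j)"

lemma sum_list_map_concat:
  "sum_list (map f (concat xss)) = (\<Sum>xs \<leftarrow> xss. sum_list (map f xs))"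
  for f :: "'a \<Rightarrow> 'b :: monoid_add"
  by (induction xss) simp_all

lemma total_drop_Nil [simp]: "total_drop [] = 0"
  by (simp add: total_drop_def)

lemma total_drop_Cons: "total_drop (x # xs) = (if xs = [] then 0 else x - hd xs) + total_drop xs"
  by (cases xs) (simp_all add: total_drop_def sum.lessThan_Suc_shift del: sum.lessThan_Suc)

text \<open>The junction contributes the truncated difference \<open>last xs - hd ys\<close>, which
  is 0.\<close>

lemma total_drop_append:
  assumes "xs \<noteq> []" "ys \<noteq> []" "last xs \<le> hd ys"
  shows "total_drop (xs @ ys) = total_drop xs + total_drop ys"
  using assms
proof (induction xs)
  case (Cons x xs)
  then show ?case by (cases "xs = []") (simp_all add: total_drop_Cons)
qed simp

text \<open>Each word ends at or below its own head, hence at or below the next head, so no junction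
  is a descent.\<close>

lemma total_drop_concat:
  assumes "sorted (map hd xss)" "\<And>xs. xs \<in> set xss \<Longrightarrow> xs \<noteq> [] \<and> last xs \<le> hd xs"
  shows "total_drop (concat xss) = sum_list (map total_drop xss)"
  using assms
proof (induction xss)
  case (Cons xs xss)
  have IH: "total_drop (concat xss) = sum_list (map total_drop xss)"
    using Cons by auto
  show ?case
  proof (cases xss)
    case (Cons ys yss)
    have "ys \<noteq> []" "xs \<noteq> []" "last xs \<le> hd xs" "hd xs \<le> hd ys"
      using Cons.prems by (auto simp: Cons)
    then have "total_drop (xs @ concat xss) = total_drop xs + total_drop (concat xss)"
      by (intro total_drop_append) (auto simp: Cons)
    then show ?thesis using IH by simp
  qed simp
qed simp

text \<open>The two sums differ only in the step that closes the cycle. That step returns to the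
  maximum \<open>m\<close>, so its truncated difference vanishes.\<close>

lemma total_drop_support:
  assumes perm: "permutation \<sigma>" and max: "\<forall>x \<in> set (support \<sigma> m). x \<le> m"
  shows "total_drop (support \<sigma> m) = (\<Sum>x \<leftarrow> support \<sigma> m. x - \<sigma> x)"
proof -
  define f where "f = (\<lambda>i. (\<sigma> ^^ i) m)"
  obtain k where k: "least_power \<sigma> m = Suc k"
    using least_power_of_permutation(2)[OF perm] gr0_implies_Suc by blast
  have s: "support \<sigma> m = map f [0..<Suc k]"
    by (simp only: k f_def)
  have "f (Suc k) = m"
    using least_power_of_permutation(1)[OF perm, of m] by (simp only: k f_def)
  moreover have "f k \<le> m"
    using max by (auto simp: s)
  ultimately have last: "f k - f (Suc k) = 0" by simp
  have "(\<Sum>x \<leftarrow> support \<sigma> m. x - \<sigma> x) = (\<Sum>i \<leftarrow> [0..<Suc k]. f i - f (Suc i))"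
    unfolding s by (simp add: f_def o_def)
  also have "\<dots> = (\<Sum>i < Suc k. f i - f (Suc i))"
    by (simp only: sum_list_distinct_conv_sum_set[OF distinct_upt] set_upt atLeast0LessThan)
  also have "\<dots> = (\<Sum>i < k. f i - f (Suc i))"
    using last by simp
  also have "\<dots> = total_drop (support \<sigma> m)"
    unfolding s total_drop_def by (intro sum.cong) (auto simp del: upt_Suc)
  finally show ?thesis by simp
qed

lemma total_drop_fundamental_bij:
  assumes \<sigma>: "\<sigma> permutes {1..n}"
  shows "total_drop (fundamental_bij n \<sigma>) = (\<Sum>x = 1..n. x - \<sigma> x)"
proof -
  let ?ms = "sorted_list_of_set (cycle_maxima n \<sigma>)"
  have perm: "permutation \<sigma>"
    using \<sigma> permutation_permutes by blast
  have fin: "finite (cycle_maxima n \<sigma>)"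
    by (simp add: cycle_maxima_def)
  have ne: "support \<sigma> m \<noteq> []" and hd: "hd (support \<sigma> m) = m" for m
    using least_power_of_permutation(2)[OF perm, of m] by (auto simp: hd_map)
  have max: "\<forall>x \<in> set (support \<sigma> m). x \<le> m" if "m \<in> set ?ms" for m
    using that fin by (auto simp: cycle_maxima_def)
  have "total_drop (fundamental_bij n \<sigma>) = sum_list (map total_drop (canonical_cycles n \<sigma>))"
    unfolding fundamental_bij_def
  proof (rule total_drop_concat)
    have "map hd (canonical_cycles n \<sigma>) = ?ms"
      unfolding canonical_cycles_def map_map o_def hd by simp
    then show "sorted (map hd (canonical_cycles n \<sigma>))" by simp
  next
    fix xs assume "xs \<in> set (canonical_cycles n \<sigma>)"
    then obtain m where m: "m \<in> set ?ms" "xs = support \<sigma> m"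
      unfolding canonical_cycles_def set_map by blast
    then show "xs \<noteq> [] \<and> last xs \<le> hd xs"
      using max ne hd last_in_set by metis
  qed
  also have "\<dots> = (\<Sum>m \<leftarrow> ?ms. \<Sum>x \<leftarrow> support \<sigma> m. x - \<sigma> x)"
    unfolding canonical_cycles_def map_map[of total_drop] o_def
    by (rule arg_cong[of _ _ sum_list], rule map_cong[OF refl], rule total_drop_support[OF perm max])
  also have "\<dots> = (\<Sum>x \<leftarrow> fundamental_bij n \<sigma>. x - \<sigma> x)"
    unfolding fundamental_bij_def canonical_cycles_def
    by (simp only: sum_list_map_concat map_map o_def)
  also have "\<dots> = (\<Sum>x = 1..n. x - \<sigma> x)"
    using fundamental_bij_in_permutations[OF \<sigma>]
    by (simp add: permutations_of_set_def sum_list_distinct_conv_sum_set)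
  finally show ?thesis .
qed

text \<open>The set over \<open>unit\<close> has cardinality 1 at a descent and 0 elsewhere. Writing
  this indicator as a cardinality lets all three terms be summed over \<open>j\<close> in the same
  way.\<close>

lemma drop_eq_pattern_counts:
  assumes \<tau>: "\<tau> \<in> permutations_of_set {1..n}" and j: "j + 1 < length \<tau>"
  shows "\<tau> ! j - \<tau> ! (j + 1) =
    card {u :: unit. \<tau> ! j > \<tau> ! (j + 1)} +
    card {i. i < j \<and> \<tau> ! (j + 1) < \<tau> ! i \<and> \<tau> ! i < \<tau> ! j} +
    card {i. j + 1 < i \<and> i < length \<tau> \<and> \<tau> ! (j + 1) < \<tau> ! i \<and> \<tau> ! i < \<tau> ! j}"
    (is "_ = card ?U + card ?L + card ?R")
proof (cases "\<tau> ! j > \<tau> ! (j + 1)")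
  case True
  let ?I = "{\<tau> ! (j + 1)..<\<tau> ! j}"
  let ?P = "{i. i < length \<tau> \<and> \<tau> ! i \<in> ?I}"
  have dist: "distinct \<tau>" and set: "set \<tau> = {1..n}"
    using \<tau> by (auto simp: permutations_of_set_def)
  have "\<tau> ! j \<in> {1..n}" "\<tau> ! (j + 1) \<in> {1..n}"
    using j set nth_mem[of _ \<tau>] by auto
  \<comment> \<open>Since \<open>\<tau>\<close> uses every value from 1 to \<open>n\<close>, none is
    missing between the two letters of the descent.\<close>
  then have I: "?I \<subseteq> set \<tau>" using set by auto
  have "(!) \<tau> ` ?P = ?I"
  proof (intro equalityI subsetI)
    fix v assume v: "v \<in> ?I"
    then obtain i where "i < length \<tau>" "\<tau> ! i = v"
      using I by (metis in_set_conv_nth subsetD)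
    then show "v \<in> (!) \<tau> ` ?P" using v by blast
  qed blast
  then have "bij_betw ((!) \<tau>) ?P ?I"
    using dist by (auto simp: bij_betw_def inj_on_def nth_eq_iff_index_eq)
  then have "\<tau> ! j - \<tau> ! (j + 1) = card ?P"
    using bij_betw_same_card by fastforce
  \<comment> \<open>Position \<open>j\<close> is excluded by the open upper end. By distinctness
    only \<open>j + 1\<close> carries the lower end, so elsewhere the inequalities are
    strict.\<close>
  also have "?P = insert (j + 1) (?L \<union> ?R)"
  proof (intro equalityI subsetI)
    fix i assume i: "i \<in> ?P"
    then have "i < length \<tau>" "i \<noteq> j" by auto
    moreover have "\<tau> ! i \<noteq> \<tau> ! (j + 1)" if "i \<noteq> j + 1"
      using that i j dist by (simp add: nth_eq_iff_index_eq)
    ultimately show "i \<in> insert (j + 1) (?L \<union> ?R)" using i by fastforce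
  qed (use True j in auto)
  also have "card \<dots> = 1 + card (?L \<union> ?R)"
    by (subst card_insert_disjoint) auto
  also have "card (?L \<union> ?R) = card ?L + card ?R"
    by (intro card_Un_disjoint) auto
  finally show ?thesis using True by simp
next
  case False
  then have "?U = {}" "?L = {}" "?R = {}" by auto
  then show ?thesis using False by simp
qed

text \<open>Double counting: occurrences of each pattern are grouped by the position
  \<open>j\<close> of their descent.\<close>

lemma total_drop_eq_occ:
  assumes \<tau>: "\<tau> \<in> permutations_of_set {1..n}"
  shows "total_drop \<tau> = occ_21 \<tau> + occ_2_31 \<tau> + occ_31_2 \<tau>"
proof -
  let ?J = "{..<length \<tau> - 1}"
  let ?U = "\<lambda>j. {u :: unit. \<tau> ! j > \<tau> ! (j + 1)}"
  let ?L = "\<lambda>j. {i. i < j \<and> \<tau> ! (j + 1) < \<tau> ! i \<and> \<tau> ! i < \<tau> ! j}"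
  let ?R = "\<lambda>j. {i. j + 1 < i \<and> i < length \<tau> \<and> \<tau> ! (j + 1) < \<tau> ! i \<and> \<tau> ! i < \<tau> ! j}"
  have "occ_21 \<tau> = card (Sigma ?J ?U)"
    unfolding occ_21_def
    by (rule bij_betw_same_card[of "\<lambda>j. (j, ())"])
      (auto simp: bij_betw_def inj_on_def image_iff split: if_splits)
  moreover have "occ_2_31 \<tau> = card (Sigma ?J ?L)"
    unfolding occ_2_31_def
    \<comment> \<open>In 2,31 the descent is the second component of the pair, while
      \<open>Sigma\<close> puts it first.\<close>
    by (rule bij_betw_same_card[of prod.swap]) (auto simp: bij_betw_def inj_on_def)
  moreover have "occ_31_2 \<tau> = card (Sigma ?J ?R)"
    unfolding occ_31_2_def by (rule arg_cong[of _ _ card]) auto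
  moreover have "total_drop \<tau> = (\<Sum>j \<in> ?J. card (?U j) + card (?L j) + card (?R j))"
    unfolding total_drop_def
    using drop_eq_pattern_counts[OF \<tau>] by (intro sum.cong) auto
  ultimately show ?thesis
    by (simp add: card_SigmaI sum.distrib)
qed

lemma sum_abs_displacement:
  assumes \<sigma>: "\<sigma> permutes A"
  shows "(\<Sum>i \<in> A. \<bar>int (\<sigma> i) - int i\<bar>) = 2 * int (\<Sum>i \<in> A. i - \<sigma> i)"
proof -
  \<comment> \<open>An absolute value is twice the negative part plus the signed value; the signed
    displacements cancel after reindexing by \<open>\<sigma>\<close>.\<close>
  have "(\<Sum>i \<in> A. \<bar>int (\<sigma> i) - int i\<bar>) = (\<Sum>i \<in> A. 2 * int (i - \<sigma> i) + (int (\<sigma> i) - int i))"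
    by (intro sum.cong) auto
  also have "\<dots> = 2 * int (\<Sum>i \<in> A. i - \<sigma> i)"
    using sum.permute[OF \<sigma>, of int] by (simp add: sum.distrib sum_subtractf sum_distrib_left o_def)
  finally show ?thesis .
qed

theorem theorem3p5:
  fixes n :: nat and \<sigma> :: "nat \<Rightarrow> nat" and \<tau> :: "nat list"
  assumes "\<sigma> permutes {1..n}"
    and "\<tau> = fundamental_bij n \<sigma>"
  shows "(\<Sum>i = 1..n. \<bar>int (\<sigma> i) - int i\<bar>) =
    2 * (int (occ_21 \<tau>) + int (occ_2_31 \<tau>) + int (occ_31_2 \<tau>))"
proof -
  have "(\<Sum>i = 1..n. i - \<sigma> i) = occ_21 \<tau> + occ_2_31 \<tau> + occ_31_2 \<tau>"
    using total_drop_fundamental_bij[OF assms(1)]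
      total_drop_eq_occ[OF fundamental_bij_in_permutations[OF assms(1)]] assms(2) by simp
  then show ?thesis using sum_abs_displacement[OF assms(1)] by simp
qed

end
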